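(* Let $f\in\mathbb{C}[X]$ be a non-trivial Casas-Alvero polynomial of degree $N\ge 5$. Then $f$ has at least five distinct roots. In particular, $N\ge 6$.
   Context: A polynomial $f\in\mathbb{C}[X]$ of degree $N\ge 1$ is called a Casas-Alvero polynomial (CA-polynomial, or "CA") if for each $i=1,\dots,N-1$ the polynomials $f$ and $f^{(i)}$ (the $i$-th derivative) have a common complex root. A polynomial is called non-trivial if it has at least two distinct roots in $\mathbb{C}$. *)

theory Defs
  imports Complex_Main "HOL-Computational_Algebra.Computational_Algebra"
begin

definition casas_alvero :: "complex poly \<Rightarrow> bool" where
  "casas_alvero f \<longleftrightarrow> degree f \<ge> 1 \<and>
     (\<forall>i\<in>{1..degree f - 1}. \<exists>z. poly f z = 0 \<and> poly ((pderiv ^^ i) f) z = 0)"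

definition nontrivial_poly :: "complex poly \<Rightarrow> bool" where
  "nontrivial_poly f \<longleftrightarrow> (\<exists>a b. a \<noteq> b \<and> poly f a = 0 \<and> poly f b = 0)"

end

theory Submission
  imports Defs "HOL-Analysis.Analysis"
begin

text \<open>
  By Gauss--Lucas, an extreme point \<open>v\<close> of the convex hull of the roots of \<open>f\<close>, of multiplicity \<open>m\<close>,
  is not a root of any \<open>f\<^sup>(\<^sup>i\<^sup>)\<close> with \<open>m \<le> i \<le> N\<close>. So from the largest such multiplicity \<open>M\<close> on, the
  common roots are among the non-extreme roots. If there is only one of those, \<open>c\<close>, then
  \<open>N f - (X - c) f'\<close> has too small a degree for its divisors. With at most four roots the only
  remaining case is that of four collinear roots, normalised to \<open>0, 1, u, v\<close> with \<open>u, v\<close> extreme.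
  A common root of two consecutive derivatives of a real-rooted polynomial is a root of all the
  lower ones, so the common roots in \<open>{0, 1}\<close> must alternate. This determines the power sums of the
  roots up to the third one, which settles \<open>M \<ge> N - 4\<close>; and if \<open>M \<le> N - 5\<close> then \<open>f\<^sup>(\<^sup>N\<^sup>-\<^sup>5\<^sup>)\<close> is a multiple of
  \<open>X (X\<^sup>2 - 5)\<^sup>2\<close>, whose double root \<open>\<surd>5\<close> would be an extreme root of \<open>f\<close>.
\<close>

subsection \<open>Roots of derivatives\<close>

text \<open>The logarithmic derivative of a product of linear factors. Indexing by \<open>I\<close>
  counts repeated roots with multiplicity.\<close>

lemma poly_pderiv_prod_linear:
  fixes r :: "'b \<Rightarrow> 'a::field"
  assumes "finite I" "\<And>i. i \<in> I \<Longrightarrow> z \<noteq> r i"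
  shows "poly (pderiv (\<Prod>i\<in>I. [:- r i, 1:])) z
           = poly (\<Prod>i\<in>I. [:- r i, 1:]) z * (\<Sum>i\<in>I. 1 / (z - r i))"
  using assms
proof (induction I rule: finite_induct)
  case (insert i I)
  let ?P = "\<Prod>i\<in>I. [:- r i, 1:]"
  have "z - r i \<noteq> 0" using insert by auto
  moreover have "poly (pderiv ?P) z = poly ?P z * (\<Sum>i\<in>I. 1 / (z - r i))"
    using insert by simp
  ultimately show ?case using insert.hyps
    by (simp add: pderiv_mult pderiv_pCons field_simps del: poly_prod mult_pCons_left)
qed simp

text \<open>From \<open>P'' / P = (P' / P)\<^sup>2 + (P' / P)'\<close>.\<close>

lemma poly_pderiv2_prod_linear:
  fixes r :: "'b \<Rightarrow> 'a::field"
  assumes "finite I" "\<And>i. i \<in> I \<Longrightarrow> z \<noteq> r i"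
  shows "poly (pderiv (pderiv (\<Prod>i\<in>I. [:- r i, 1:]))) z
           = poly (\<Prod>i\<in>I. [:- r i, 1:]) z * ((\<Sum>i\<in>I. 1 / (z - r i))\<^sup>2 - (\<Sum>i\<in>I. 1 / (z - r i)^2))"
  using assms
proof (induction I rule: finite_induct)
  case (insert i I)
  let ?P = "\<Prod>i\<in>I. [:- r i, 1:]" and ?S = "\<Sum>i\<in>I. 1 / (z - r i)" and ?T = "\<Sum>i\<in>I. 1 / (z - r i)^2"
  define w where "w = z - r i"
  have w: "w \<noteq> 0" using insert by (auto simp: w_def)
  have 1: "poly (pderiv ?P) z = poly ?P z * ?S"
    using insert by (intro poly_pderiv_prod_linear) auto
  have 2: "poly (pderiv (pderiv ?P)) z = poly ?P z * (?S\<^sup>2 - ?T)"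
    using insert by simp
  have "poly (pderiv (pderiv ([:- r i, 1:] * ?P))) z
      = 2 * poly (pderiv ?P) z + w * poly (pderiv (pderiv ?P)) z"
    by (simp add: pderiv_mult pderiv_pCons pderiv_add algebra_simps w_def del: poly_prod mult_pCons_left)
  also have "\<dots> = w * poly ?P z * ((1 / w + ?S)\<^sup>2 - (1 / w^2 + ?T))"
    unfolding 1 2 using w by (simp add: field_simps power2_eq_square)
  finally show ?case using insert.hyps by (simp add: w_def del: poly_prod mult_pCons_left)
qed simp

text \<open>\<open>p' / p\<close> at \<open>z\<close> is the sum of \<open>1 / (z - x)\<close> over
  the roots. Divided by \<open>c\<close>, every summand has nonnegative real part and that of
  \<open>x0\<close> a positive one.\<close>

lemma poly_pderiv_nonzero_halfplane:
  fixes p :: "complex poly"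
  assumes z: "poly p z \<noteq> 0"
    and ge: "\<And>x. poly p x = 0 \<Longrightarrow> Re (c * (z - x)) \<ge> 0"
    and x0: "poly p x0 = 0" "Re (c * (z - x0)) > 0"
  shows "poly (pderiv p) z \<noteq> 0"
proof
  assume d: "poly (pderiv p) z = 0"
  obtain r where r: "smult (lead_coeff p) (\<Prod>i<degree p. [:- r i, 1:]) = p"
    using complex_poly_decompose' by blast
  let ?P = "\<Prod>i<degree p. [:- r i, 1:]"
  have lc: "lead_coeff p \<noteq> 0" using z by auto
  have root: "poly p x = 0 \<longleftrightarrow> (\<exists>i<degree p. x = r i)" for x
    using lc by (subst r[symmetric]) (auto simp: poly_prod)
  have ne: "z \<noteq> r i" if "i < degree p" for i using z root that by auto
  have "poly (pderiv p) z = lead_coeff p * (poly ?P z * (\<Sum>i<degree p. 1 / (z - r i)))"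
    using ne by (subst r[symmetric], subst pderiv_smult, subst poly_smult, subst poly_pderiv_prod_linear) auto
  moreover have "poly ?P z \<noteq> 0" using ne by (auto simp: poly_prod)
  ultimately have s: "(\<Sum>i<degree p. 1 / (z - r i)) = 0" using d lc by simp
  have c: "c \<noteq> 0" using x0 by auto
  have "(\<Sum>i<degree p. Re (1 / (c * (z - r i)))) > 0"
  proof -
    obtain i where i: "i < degree p" "x0 = r i" using x0 root by auto
    have R: "Re (1 / w) = Re w / (cmod w)\<^sup>2" for w
      by (simp add: Re_divide cmod_power2)
    show ?thesis
    proof (rule sum_pos2[of _ i])
      show "0 < Re (1 / (c * (z - r i)))" unfolding R using x0 i by (intro divide_pos_pos) auto
      show "0 \<le> Re (1 / (c * (z - r j)))" if "j \<in> {..<degree p}" for j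
        unfolding R using ge root that by (intro divide_nonneg_nonneg) auto
    qed (use i in auto)
  qed
  also have "(\<Sum>i<degree p. Re (1 / (c * (z - r i)))) = Re (1 / c * (\<Sum>i<degree p. 1 / (z - r i)))"
    unfolding sum_distrib_left Re_sum by simp
  finally show False using s by simp
qed

text \<open>The exposed case of Gauss--Lucas: \<^term>\<open>v\<close> is kept separate from the open half-plane
  because the derivatives below the multiplicity of \<^term>\<open>v\<close> still vanish there.\<close>
lemma pderiv_root_exposed:
  fixes p :: "complex poly"
  assumes deg: "degree p \<ge> 1"
    and Q: "\<And>x. poly p x = 0 \<Longrightarrow> x = v \<or> Re (c * (x - v)) < 0"
    and z: "poly (pderiv p) z = 0" "poly p z \<noteq> 0"
  shows "Re (c * (z - v)) < 0"
proof (rule ccontr)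
  assume "\<not> ?thesis"
  hence zv: "Re (c * (z - v)) \<ge> 0" by simp
  have split: "Re (c * (z - x)) = Re (c * (z - v)) - Re (c * (x - v))" for x
    by (simp add: algebra_simps)
  obtain x0 where x0: "poly p x0 = 0"
    using deg fundamental_theorem_of_algebra_alt[of p] by (metis degree_pCons_0 not_one_le_zero)
  show False
  proof (cases "\<exists>x. poly p x = 0 \<and> x \<noteq> v")
    case True
    then obtain x where x: "poly p x = 0" "x \<noteq> v" by blast
    have "Re (c * (z - y)) \<ge> 0" if "poly p y = 0" for y
      using Q[OF that] zv by (subst split) auto
    moreover have "Re (c * (z - x)) > 0"
      using Q[OF x(1)] x(2) zv by (subst split) auto
    ultimately have "poly (pderiv p) z \<noteq> 0"
      using x by (intro poly_pderiv_nonzero_halfplane[OF z(2), of c x])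
    thus False using z by simp
  next
    case False
    hence v: "\<And>x. poly p x = 0 \<Longrightarrow> x = v" by blast
    hence "z \<noteq> v" using x0 z by auto
    \<comment> \<open>With \<open>v\<close> as the only root, the multiplier
      \<open>1 / (z - v)\<close> puts \<open>z\<close> strictly on the right side.\<close>
    hence 1: "Re (1 / (z - v) * (z - v)) = 1" by simp
    have "poly (pderiv p) z \<noteq> 0"
    proof (rule poly_pderiv_nonzero_halfplane[OF z(2)])
      show "Re (1 / (z - v) * (z - x)) \<ge> 0" if "poly p x = 0" for x
        using 1 v[OF that] by simp
      show "poly p v = 0" using v x0 by auto
      show "Re (1 / (z - v) * (z - v)) > 0" using 1 by simp
    qed
    thus False using z by simp
  qed
qed

section \<open>Multiplicities and extreme roots\<close>

lemma funpow_pderiv_order_nonzero: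
  fixes p :: "complex poly"
  assumes "p \<noteq> 0"
  shows "poly ((pderiv ^^ order v p) p) v \<noteq> 0"
  using assms
proof (induction "order v p" arbitrary: p)
  case 0
  thus ?case by (metis funpow_0 order_root)
next
  case (Suc n)
  hence r: "poly p v = 0" by (metis order_root nat.distinct(1))
  have o: "order v p = Suc (order v (pderiv p))" by (rule order_pderiv) (use Suc r in auto)
  have "pderiv p \<noteq> 0" using r Suc.prems
    by (metis degree_eq_zeroE pderiv_eq_0_iff poly_const_conv pCons_0_0)
  hence "poly ((pderiv ^^ order v (pderiv p)) (pderiv p)) v \<noteq> 0"
    using Suc.hyps(1)[of "pderiv p"] Suc.hyps(2) o by simp
  thus ?case by (simp add: o funpow_swap1)
qed

lemma order_ge_if_pderivs_vanish:
  fixes p :: "complex poly"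
  assumes "p \<noteq> 0" "\<And>i. i < n \<Longrightarrow> poly ((pderiv ^^ i) p) v = 0"
  shows "n \<le> order v p"
  using funpow_pderiv_order_nonzero[OF assms(1), of v] assms(2) by (meson not_le)

text \<open>Separation puts the other roots in an open half-plane bounded by a line through
  \<open>v\<close>, and \<open>pderiv_root_exposed\<close> keeps there every new root of a
  derivative. So \<open>v\<close>, once lost at order \<open>order v p\<close>, cannot come
  back.\<close>

lemma pderivs_nonzero_at_extreme_root:
  fixes p :: "complex poly"
  assumes p: "p \<noteq> 0"
    and v: "v extreme_point_of (convex hull {x. poly p x = 0})"
    and i: "order v p \<le> i" "i \<le> degree p"
  shows "poly ((pderiv ^^ i) p) v \<noteq> 0"
proof -
  let ?S = "{x. poly p x = 0}"
  have fin: "finite ?S" using p by (rule poly_roots_finite)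
  have "convex (convex hull ?S - {v})"
    using v extreme_point_of_stillconvex[of "convex hull ?S" v] by simp
  moreover have "?S - {v} \<subseteq> convex hull ?S - {v}" using hull_subset[of ?S convex] by auto
  ultimately have "convex hull (?S - {v}) \<subseteq> convex hull ?S - {v}" by (intro hull_minimal) auto
  hence nv: "v \<notin> convex hull (?S - {v})" by auto
  obtain a b where ab: "a \<bullet> v < b" "\<And>x. x \<in> convex hull (?S - {v}) \<Longrightarrow> a \<bullet> x > b"
    using separating_hyperplane_closed_point[OF _ _ nv] fin
    by (metis convex_convex_hull finite_Diff finite_imp_compact_convex_hull compact_imp_closed)
  \<comment> \<open>Then \<open>Re (c * w) = - (a \<bullet> w)\<close>, which turns the separating
    functional into complex multiplication.\<close>
  define c where "c = - cnj a"
  have Q0: "x = v \<or> Re (c * (x - v)) < 0" if "poly p x = 0" for x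
  proof (cases "x = v")
    case False
    hence "x \<in> convex hull (?S - {v})" using that by (intro hull_inc) auto
    with ab have "a \<bullet> v < a \<bullet> x" by fastforce
    thus ?thesis by (simp add: c_def inner_complex_def algebra_simps)
  qed simp
  have Q: "x = v \<or> Re (c * (x - v)) < 0" if "poly ((pderiv ^^ i) p) x = 0" "i \<le> degree p" for i x
    using that
  proof (induction i arbitrary: x)
    case 0 thus ?case using Q0 by simp
  next
    case (Suc i)
    show ?case
    proof (cases "poly ((pderiv ^^ i) p) x = 0")
      case False
      hence "Re (c * (x - v)) < 0" using Suc
        by (intro pderiv_root_exposed[of "(pderiv ^^ i) p" v c x]) (simp_all add: degree_higher_pderiv)
      thus ?thesis ..
    qed (use Suc in auto)
  qed
  from i show ?thesis
  proof (induction i rule: dec_induct)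
    case base show ?case by (rule funpow_pderiv_order_nonzero[OF p])
  next
    case (step i)
    show ?case
    proof
      assume "poly ((pderiv ^^ Suc i) p) v = 0"
      hence "Re (c * (v - v)) < 0" using step Q[of i]
        by (intro pderiv_root_exposed[of "(pderiv ^^ i) p" v c v]) (auto simp: degree_higher_pderiv)
      thus False by simp
    qed
  qed
qed

section \<open>Derivatives of real-rooted polynomials\<close>

lemma pderivs_real_rooted:
  fixes p :: "complex poly"
  assumes "\<And>x. poly p x = 0 \<Longrightarrow> x \<in> \<real>" "i < degree p" "poly ((pderiv ^^ i) p) z = 0"
  shows "z \<in> \<real>"
  using assms(2,3)
proof (induction i arbitrary: z)
  case 0 thus ?case using assms(1) by simp
next
  case (Suc i)
  let ?q = "(pderiv ^^ i) p"
  have "degree ?q \<noteq> 0" using Suc by (simp add: degree_higher_pderiv)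
  then obtain x0 where x0: "poly ?q x0 = 0"
    using fundamental_theorem_of_algebra_alt[of ?q] by (metis degree_pCons_0)
  have re: "Im x = 0" if "poly ?q x = 0" for x
    using Suc that by (simp add: complex_is_Real_iff)
  show ?case
  proof (rule ccontr)
    assume z: "z \<notin> \<real>"
    hence nz: "poly ?q z \<noteq> 0" "Im z \<noteq> 0" using re by (auto simp: complex_is_Real_iff)
    \<comment> \<open>For real \<open>x\<close> this multiplier gives
      \<open>Re (c * (z - x)) = (Im z)\<^sup>2\<close>.\<close>
    have "poly (pderiv ?q) z \<noteq> 0"
      by (rule poly_pderiv_nonzero_halfplane[OF nz(1), of "- \<i> * Im z" x0])
         (use re x0 nz in \<open>auto simp flip: power2_eq_square\<close>)
    thus False using Suc by simp
  qed
qed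

text \<open>Otherwise the two equations make first the sum of the \<open>1 / (z - r i)\<close> and
  then that of their squares vanish, but the latter is a sum of positive reals.\<close>

lemma real_rooted_pderiv_double_root:
  fixes p :: "complex poly"
  assumes re: "\<And>x. poly p x = 0 \<Longrightarrow> x \<in> \<real>" and deg: "degree p \<ge> 1"
    and z: "z \<in> \<real>" "poly (pderiv p) z = 0" "poly (pderiv (pderiv p)) z = 0"
  shows "poly p z = 0"
proof (rule ccontr)
  assume nz: "poly p z \<noteq> 0"
  obtain r where r: "smult (lead_coeff p) (\<Prod>i<degree p. [:- r i, 1:]) = p"
    using complex_poly_decompose' by blast
  let ?P = "\<Prod>i<degree p. [:- r i, 1:]"
  have lc: "lead_coeff p \<noteq> 0" using nz by auto
  have root: "poly p x = 0 \<longleftrightarrow> (\<exists>i<degree p. x = r i)" for x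
    using lc by (subst r[symmetric]) (auto simp: poly_prod)
  have ne: "z \<noteq> r i" if "i < degree p" for i using nz root that by auto
  have P: "poly ?P z \<noteq> 0" using ne by (auto simp: poly_prod)
  have "poly (pderiv p) z = lead_coeff p * (poly ?P z * (\<Sum>i<degree p. 1 / (z - r i)))"
    using ne by (subst r[symmetric], subst pderiv_smult, subst poly_smult, subst poly_pderiv_prod_linear) auto
  hence s1: "(\<Sum>i<degree p. 1 / (z - r i)) = 0" using z lc P by simp
  have "poly (pderiv (pderiv p)) z = lead_coeff p * (poly ?P z *
      ((\<Sum>i<degree p. 1 / (z - r i))\<^sup>2 - (\<Sum>i<degree p. 1 / (z - r i)^2)))"
    using ne by (subst r[symmetric], subst pderiv_smult, subst pderiv_smult, subst poly_smult,
        subst poly_pderiv2_prod_linear) auto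
  hence s2: "(\<Sum>i<degree p. 1 / (z - r i)^2) = 0" using z lc P s1 by simp
  have zr: "z = of_real (Re z)" using z(1) by (simp add: of_real_Re)
  have rr: "r i = of_real (Re (r i))" if "i < degree p" for i
    using re[of "r i"] root[of "r i"] that by (metis of_real_Re)
  have "1 / (z - r i)^2 = of_real (1 / (Re z - Re (r i))^2)" if "i < degree p" for i
  proof -
    note zr rr[OF that]
    thus ?thesis by (metis of_real_1 of_real_diff of_real_divide of_real_power)
  qed
  hence "of_real (\<Sum>i<degree p. 1 / (Re z - Re (r i))^2) = (0 :: complex)"
    using s2 unfolding of_real_sum by simp
  hence s3: "(\<Sum>i<degree p. 1 / (Re z - Re (r i))^2) = 0" by (simp only: of_real_eq_0_iff)
  have "Re z - Re (r i) \<noteq> 0" if "i < degree p" for i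
    using ne[OF that] zr rr[OF that] by (metis right_minus_eq)
  hence "(\<Sum>i<degree p. 1 / (Re z - Re (r i))^2) > 0"
    using deg by (intro sum_pos) (auto simp: lessThan_empty_iff)
  thus False using s3 by simp
qed

text \<open>All derivatives involved are real-rooted, so
  \<open>real_rooted_pderiv_double_root\<close> pushes the common root down one order at a time. Its
  multiplicity in \<open>p\<close> is thus at least \<open>i + 2\<close>.\<close>

lemma real_rooted_pderivs_common_root:
  fixes p :: "complex poly"
  assumes re: "\<And>x. poly p x = 0 \<Longrightarrow> x \<in> \<real>" and i: "Suc i < degree p" and z: "z \<in> \<real>"
    and r: "poly ((pderiv ^^ i) p) z = 0" "poly ((pderiv ^^ Suc i) p) z = 0"
    and "j \<le> Suc i"
  shows "poly ((pderiv ^^ j) p) z = 0"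
proof -
  have "poly ((pderiv ^^ j) p) z = 0 \<and> poly ((pderiv ^^ Suc j) p) z = 0" if "j \<le> i" for j
    using that
  proof (induction j rule: inc_induct)
    case base show ?case using r by simp
  next
    case (step j)
    have "poly ((pderiv ^^ j) p) z = 0"
      by (rule real_rooted_pderiv_double_root)
         (use step i z in \<open>auto simp: degree_higher_pderiv intro: pderivs_real_rooted[where p = p and i = j, OF re]\<close>)
    thus ?case using step by simp
  qed
  from this[of j] show ?thesis using assms r by (cases "j = Suc i") auto
qed

subsection \<open>Casas-Alvero polynomials with few non-extreme roots\<close>

lemma sum_order_eq_degree:
  fixes p :: "complex poly"
  assumes "p \<noteq> 0"
  shows "(\<Sum>x | poly p x = 0. order x p) = degree p"
  using size_proots_complex[of p] assms by (simp add: size_multiset_overloaded_eq)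

lemma sum_order_le_degree:
  fixes p :: "complex poly"
  assumes "p \<noteq> 0" "finite T"
  shows "(\<Sum>x\<in>T. order x p) \<le> degree p"
proof -
  have "(\<Sum>x\<in>T. order x p) = (\<Sum>x\<in>T \<inter> {x. poly p x = 0}. order x p)"
    using assms by (intro sum.mono_neutral_right) (auto simp: order_root)
  also have "\<dots> \<le> (\<Sum>x | poly p x = 0. order x p)"
    using assms by (intro sum_mono2 poly_roots_finite) auto
  finally show ?thesis by (simp add: sum_order_eq_degree assms)
qed

lemma poly_higher_pderiv_degree:
  fixes p :: "complex poly"
  shows "poly ((pderiv ^^ degree p) p) z = fact (degree p) * lead_coeff p"
proof -
  have "degree ((pderiv ^^ degree p) p) = 0" by (simp add: degree_higher_pderiv)
  then obtain a where a: "(pderiv ^^ degree p) p = [:a:]" by (rule degree_eq_zeroE)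
  hence "a = coeff ((pderiv ^^ degree p) p) 0" by simp
  also have "\<dots> = fact (degree p) * lead_coeff p" by (simp add: coeff_higher_pderiv pochhammer_fact)
  finally show ?thesis using a by simp
qed

text \<open>The derivative of order \<open>degree p\<close> is a nonzero constant, so its order must
  be below \<open>M\<close>.\<close>

lemma degree_less_if_higher_pderivs_vanish:
  fixes p :: "complex poly"
  assumes "p \<noteq> 0" "\<And>i. i \<ge> M \<Longrightarrow> poly ((pderiv ^^ i) p) c = 0"
  shows "degree p < M"
  using assms(2)[of "degree p"] assms(1) poly_higher_pderiv_degree[of p c] by (cases "M \<le> degree p") auto

text \<open>At \<open>c\<close> only the second term survives, so there the \<open>i\<close>-th
  derivative of \<open>N p - (X - c) p'\<close> is \<open>N - i\<close> times that of
  \<open>p\<close>.\<close>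

lemma higher_pderiv_linear_mult_pderiv:
  fixes p :: "complex poly"
  shows "(pderiv ^^ i) ([:- c, 1:] * pderiv p)
           = [:- c, 1:] * (pderiv ^^ Suc i) p + smult (of_nat i) ((pderiv ^^ i) p)"
proof (induction i)
  case (Suc i)
  have "(pderiv ^^ Suc i) ([:- c, 1:] * pderiv p)
      = pderiv ([:- c, 1:] * (pderiv ^^ Suc i) p + smult (of_nat i) ((pderiv ^^ i) p))"
    using Suc by simp
  also have "\<dots> = [:- c, 1:] * pderiv ((pderiv ^^ Suc i) p) + (pderiv ^^ Suc i) p
       + smult (of_nat i) (pderiv ((pderiv ^^ i) p))"
    unfolding pderiv_add pderiv_mult pderiv_smult by (simp add: pderiv_pCons one_pCons[symmetric] add_ac del: mult_pCons_left)
  finally show ?case by (simp add: smult_add_left add_ac del: mult_pCons_left)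
qed simp

lemma casas_alvero_common_root:
  assumes "casas_alvero f" "1 \<le> i" "i < degree f"
  obtains z where "poly f z = 0" "poly ((pderiv ^^ i) f) z = 0"
  using assms unfolding casas_alvero_def by (metis atLeastAtMost_iff less_imp_diff_less less_Suc_eq_le Suc_diff_1 not_gr_zero not_less_zero zero_less_one order_less_le_trans)

text \<open>All derivatives of order at least the largest multiplicity \<open>M\<close> of an extreme root vanish at
  the only remaining root \<open>c\<close>, so \<open>N f - (X - c) f'\<close> has degree less than \<open>M\<close>; but it is divisible
  by \<open>(X - v) ^ (M - 1) (X - c)\<close>.\<close>
lemma casas_alvero_two_nonextreme_roots:
  assumes ca: "casas_alvero f" and nt: "nontrivial_poly f"
  shows "\<exists>c d. c \<noteq> d \<and> poly f c = 0 \<and> poly f d = 0 \<and>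
           \<not> c extreme_point_of (convex hull {x. poly f x = 0}) \<and>
           \<not> d extreme_point_of (convex hull {x. poly f x = 0})"
proof (rule ccontr)
  assume contra: "\<not> ?thesis"
  define N where "N = degree f"
  define S where "S = {x. poly f x = 0}"
  define E where "E = {x. x extreme_point_of (convex hull S)}"
  have one: "c = d" if "c \<in> S - E" "d \<in> S - E" for c d
    using that contra by (auto simp: S_def E_def)
  have f0: "f \<noteq> 0" using ca by (auto simp: casas_alvero_def)
  have N1: "N \<ge> 1" using ca by (simp add: casas_alvero_def N_def)
  have fin: "finite S" unfolding S_def using f0 by (rule poly_roots_finite)
  have ES: "E \<subseteq> S" using extreme_point_of_convex_hull by (auto simp: E_def)
  obtain a b where ab: "a \<noteq> b" "a \<in> S" "b \<in> S" using nt by (auto simp: nontrivial_poly_def S_def)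
  have "convex hull S = convex hull E" unfolding E_def by (rule Krein_Milman_polytope[OF fin])
  hence Ene: "E \<noteq> {}" using ab hull_subset[of S convex] by auto
  have finE: "finite E" using ES fin by (rule finite_subset)
  define M where "M = Max ((\<lambda>v. order v f) ` E)"
  obtain v where v: "v \<in> E" "order v f = M"
    using Max_in[of "(\<lambda>v. order v f) ` E"] finE Ene unfolding M_def by fastforce
  have le: "order w f \<le> M" if "w \<in> E" for w unfolding M_def using finE that by auto
  have nz: "poly ((pderiv ^^ i) f) w \<noteq> 0" if "w \<in> E" "M \<le> i" "i \<le> N" for w i
    using pderivs_nonzero_at_extreme_root[OF f0, of w i] that le[of w] by (auto simp: E_def S_def N_def)
  have pos: "order x f \<ge> 1" if "x \<in> S" for x
    using that f0 by (auto simp: S_def order_root)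
  have M1: "1 \<le> M" using pos[of v] v ES by auto
  have "order v f + order w f \<le> N" if "w \<noteq> v" for w
    using sum_order_le_degree[OF f0, of "{v, w}"] that by (simp add: N_def)
  hence MN: "M < N" using ab v pos by (metis Suc_eq_plus1 add_le_cancel_left dual_order.trans less_eq_Suc_le)
  have ex: "\<exists>z\<in>S - E. poly ((pderiv ^^ i) f) z = 0" if "M \<le> i" "i < N" for i
  proof -
    have "1 \<le> i" "i < degree f" using that M1 by (auto simp: N_def)
    then obtain z where "poly f z = 0" "poly ((pderiv ^^ i) f) z = 0"
      by (rule casas_alvero_common_root[OF ca])
    thus ?thesis using nz[of z i] that by (auto simp: S_def)
  qed
  from ex[of M] MN obtain c where c: "c \<in> S - E" by auto
  have fc: "poly ((pderiv ^^ i) f) c = 0" if "M \<le> i" "i < N" for i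
    using ex[OF that] one[OF c] by auto
  have vc: "v \<noteq> c" using c v by auto
  define g where "g = smult (of_nat N) f - [:- c, 1:] * pderiv f"
  have "order v f = Suc (order v (pderiv f))"
    by (rule order_pderiv) (use f0 v ES in \<open>auto simp: S_def\<close>)
  hence o': "order v (pderiv f) = M - 1" using v by simp
  have f'0: "pderiv f \<noteq> 0" using N1 by (auto simp: pderiv_eq_0_iff N_def)
  have g0: "g \<noteq> 0"
  proof
    assume "g = 0"
    hence eq: "smult (of_nat N) f = [:- c, 1:] * pderiv f" by (simp add: g_def)
    \<comment> \<open>The two sides of \<open>eq\<close> have different multiplicities at
      \<open>v\<close>: \<open>M\<close> on the left and, as \<open>v \<noteq> c\<close>,
      \<open>M - 1\<close> on the right.\<close>
    have "order v (smult (of_nat N) f) = order v f" using N1 by (intro order_smult) auto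
    moreover have "order v ([:- c, 1:] * pderiv f) = order v [:- c, 1:] + order v (pderiv f)"
      using f'0 by (intro order_mult) (simp only: mult_eq_0_iff, simp)
    moreover have "order v [:- c, 1:] = 0" using vc by (intro order_0I) auto
    ultimately show False using v o' eq M1 by simp
  qed
  have "poly ((pderiv ^^ i) g) c = 0" if "M \<le> i" for i
  proof -
    have "(pderiv ^^ i) g = (pderiv ^^ i) (smult (of_nat N) f + smult (-1) ([:- c, 1:] * pderiv f))"
      by (simp add: g_def del: mult_pCons_left)
    also have "\<dots> = smult (of_nat N) ((pderiv ^^ i) f)
        + smult (-1) ([:- c, 1:] * (pderiv ^^ Suc i) f + smult (of_nat i) ((pderiv ^^ i) f))"
      unfolding higher_pderiv_add higher_pderiv_smult higher_pderiv_linear_mult_pderiv ..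
    finally have e: "(pderiv ^^ i) g = \<dots>" .
    \<comment> \<open>The factor \<open>N - i\<close> removes the nonzero constant derivative at
      \<open>i = N\<close>; the other orders from \<open>M\<close> on contribute 0 already.\<close>
    have "poly ((pderiv ^^ i) g) c = (of_nat N - of_nat i) * poly ((pderiv ^^ i) f) c"
      unfolding e by (simp add: left_diff_distrib del: mult_pCons_left)
    moreover have "(pderiv ^^ i) f = 0" if "i > N"
      using that by (intro poly_eqI) (simp add: coeff_higher_pderiv coeff_eq_0 N_def)
    ultimately show ?thesis using fc[OF that] by (cases i N rule: linorder_cases) auto
  qed
  hence "degree g < M" by (rule degree_less_if_higher_pderivs_vanish[OF g0])
  moreover have "order v g \<ge> M - 1"
  proof -
    have "[:- v, 1:] ^ (M - 1) dvd f" using v by (simp add: order_divides)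
    moreover have "[:- v, 1:] ^ (M - 1) dvd pderiv f" using o' by (simp add: order_divides)
    ultimately have "[:- v, 1:] ^ (M - 1) dvd g" unfolding g_def
      by (intro dvd_diff dvd_smult dvd_mult)
    thus ?thesis using g0 by (simp add: order_divides)
  qed
  moreover have "order c g \<ge> 1"
    using c g0 order_root[of g c] by (auto simp: g_def S_def)
  moreover have "order v g + order c g \<le> degree g"
    using sum_order_le_degree[OF g0, of "{v, c}"] vc by simp
  ultimately show False using M1 by simp
qed

text \<open>The hull is spanned by its extreme points, of which at most two are left. Since it
  contains \<open>c \<noteq> d\<close>, there are exactly two, and the hull is a segment.\<close>

lemma four_points_collinear:
  fixes S :: "'a::euclidean_space set"
  assumes "finite S" "card S \<le> 4" "c \<in> S" "d \<in> S" "c \<noteq> d"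
    and nc: "\<not> c extreme_point_of (convex hull S)" and nd: "\<not> d extreme_point_of (convex hull S)"
  obtains a b where "S = {a, b, c, d}" "a \<noteq> b" "a \<notin> {c, d}" "b \<notin> {c, d}" "c \<in> closed_segment a b"
    "d \<in> closed_segment a b" "a extreme_point_of (convex hull S)" "b extreme_point_of (convex hull S)"
proof -
  define E where "E = {x. x extreme_point_of (convex hull S)}"
  have ES: "E \<subseteq> S" using extreme_point_of_convex_hull by (auto simp: E_def)
  hence E: "E \<subseteq> S - {c, d}" using nc nd by (auto simp: E_def)
  have "card (S - {c, d}) \<le> 2" using assms by (simp add: card_Diff_subset)
  hence card: "card E \<le> 2" using card_mono[OF _ E] assms(1) by simp
  have hull: "convex hull S = convex hull E" unfolding E_def by (rule Krein_Milman_polytope[OF assms(1)])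
  hence cE: "c \<in> convex hull E" "d \<in> convex hull E" using assms hull_inc by metis+
  have finE: "finite E" using ES assms(1) by (rule finite_subset)
  have "card E \<noteq> 0" using finE cE by auto
  moreover have "card E \<noteq> 1" using cE \<open>c \<noteq> d\<close> by (auto simp: card_1_singleton_iff)
  ultimately have "card E = 2" using card by simp
  then obtain a b where ab: "E = {a, b}" "a \<noteq> b" by (auto simp: card_2_iff)
  have "S = {a, b, c, d}"
  proof (rule card_seteq[symmetric])
    show "{a, b, c, d} \<subseteq> S" using ab E assms by auto
    have "card {a, b, c, d} = 4" using ab E \<open>c \<noteq> d\<close> by (auto simp: card_insert_if)
    thus "card S \<le> card {a, b, c, d}" using assms by simp
  qed (use assms in auto)
  thus ?thesis using that[of a b] ab E cE by (auto simp: E_def segment_convex_hull)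
qed

subsection \<open>Power sums of the roots\<close>

text \<open>Newton's identities: the coefficients are, up to sign, the elementary symmetric
  functions of \<open>A\<close>. The reversed factors \<open>1 - x X\<close> put them in fixed low
  degrees, and the factors 2 and 6 avoid division.\<close>

lemma coeff_prod_mset_one_minus:
  fixes A :: "'a::idom multiset"
  defines "P \<equiv> \<Prod>x\<in>#A. [:1, - x:]"
    and "p1 \<equiv> (\<Sum>x\<in>#A. x)" and "p2 \<equiv> (\<Sum>x\<in>#A. x\<^sup>2)" and "p3 \<equiv> (\<Sum>x\<in>#A. x ^ 3)"
  shows "coeff P 0 = 1" "coeff P 1 = - p1" "2 * coeff P 2 = p1\<^sup>2 - p2"
    and "6 * coeff P 3 = - (p1 ^ 3) + 3 * p1 * p2 - 2 * p3"
proof -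
  have "coeff P 0 = 1 \<and> coeff P 1 = - p1 \<and> 2 * coeff P 2 = p1\<^sup>2 - p2 \<and>
    6 * coeff P 3 = - (p1 ^ 3) + 3 * p1 * p2 - 2 * p3"
    unfolding assms
  proof (induction A)
    case (add x A)
    let ?P = "\<Prod>x\<in>#A. [:1, - x:]"
    have "coeff ([:1, - x:] * ?P) (Suc j) = coeff ?P (Suc j) - x * coeff ?P j" for j
      by (simp add: coeff_pCons)
    from this[of 0] this[of 1] this[of 2]
    have c: "coeff ([:1, - x:] * ?P) 1 = coeff ?P 1 - x * coeff ?P 0"
      "coeff ([:1, - x:] * ?P) 2 = coeff ?P 2 - x * coeff ?P 1"
      "coeff ([:1, - x:] * ?P) 3 = coeff ?P 3 - x * coeff ?P 2"
      by (simp_all add: numeral_2_eq_2 numeral_3_eq_3)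
    have c0: "coeff ([:1, - x:] * ?P) 0 = coeff ?P 0" by simp
    let ?p1 = "\<Sum>x\<in>#A. x" and ?p2 = "\<Sum>x\<in>#A. x\<^sup>2" and ?p3 = "\<Sum>x\<in>#A. x ^ 3"
    have "2 * (coeff ?P 2 - x * coeff ?P 1) = 2 * coeff ?P 2 - 2 * x * coeff ?P 1"
      by (simp add: algebra_simps)
    also have "\<dots> = (x + ?p1)\<^sup>2 - (x\<^sup>2 + ?p2)"
      using add by (simp add: algebra_simps power2_eq_square)
    finally have 2: "2 * (coeff ?P 2 - x * coeff ?P 1) = (x + ?p1)\<^sup>2 - (x\<^sup>2 + ?p2)" .
    have "6 * (coeff ?P 3 - x * coeff ?P 2) = 6 * coeff ?P 3 - 3 * x * (2 * coeff ?P 2)"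
      by (simp add: algebra_simps)
    also have "\<dots> = (- (?p1 ^ 3) + 3 * ?p1 * ?p2 - 2 * ?p3) - 3 * x * (?p1\<^sup>2 - ?p2)"
      using add by simp
    also have "\<dots> = - ((x + ?p1) ^ 3) + 3 * (x + ?p1) * (x\<^sup>2 + ?p2) - 2 * (x ^ 3 + ?p3)"
      by (simp add: algebra_simps power2_eq_square power3_eq_cube)
    finally have 3: "6 * (coeff ?P 3 - x * coeff ?P 2)
      = - ((x + ?p1) ^ 3) + 3 * (x + ?p1) * (x\<^sup>2 + ?p2) - 2 * (x ^ 3 + ?p3)" .
    show ?case
      unfolding image_mset_add_mset prod_mset.add_mset sum_mset.add_mset c c0
      using add 2 3 by simp
  qed (simp_all add: numeral_eq_Suc)
  thus "coeff P 0 = 1" "coeff P 1 = - p1" "2 * coeff P 2 = p1\<^sup>2 - p2"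
    "6 * coeff P 3 = - (p1 ^ 3) + 3 * p1 * p2 - 2 * p3" by blast+
qed

text \<open>Up to the leading coefficient, reflection turns the top coefficients of \<open>p\<close>
  into the lowest ones of the product of the \<open>1 - x X\<close>.\<close>

lemma newton_top_coeffs:
  fixes p :: "complex poly"
  defines "p1 \<equiv> (\<Sum>x\<in>#proots p. x)" and "p2 \<equiv> (\<Sum>x\<in>#proots p. x\<^sup>2)" and "p3 \<equiv> (\<Sum>x\<in>#proots p. x ^ 3)"
  assumes deg: "degree p = n + 3"
  shows "coeff p (n + 2) = - lead_coeff p * p1"
    and "2 * coeff p (n + 1) = lead_coeff p * (p1\<^sup>2 - p2)"
    and "6 * coeff p n = lead_coeff p * (- (p1 ^ 3) + 3 * p1 * p2 - 2 * p3)"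
proof -
  let ?P = "\<Prod>x\<in>#proots p. [:1, - x:]"
  \<comment> \<open>This includes \<open>x = 0\<close>, where \<open>X\<close> reflects to the
    constant 1.\<close>
  have lin: "reflect_poly [:- x, 1:] = [:1, - x:]" for x :: complex
    by (intro poly_eqI) (auto simp: coeff_reflect_poly coeff_pCons split: nat.split)
  have "reflect_poly (\<Prod>x\<in>#A. [:- x, 1:]) = (\<Prod>x\<in>#A. [:1, - x:])" for A :: "complex multiset"
    by (induction A) (simp_all add: reflect_poly_mult lin del: mult_pCons_left)
  hence "reflect_poly p = smult (lead_coeff p) ?P"
    by (metis complex_poly_decompose_multiset reflect_poly_smult)
  hence c: "coeff p (degree p - j) = lead_coeff p * coeff ?P j" if "j \<le> degree p" for j
    using that coeff_reflect_poly[of p j] by simp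
  note C = coeff_prod_mset_one_minus[of "proots p", folded p1_def p2_def p3_def]
  show "coeff p (n + 2) = - lead_coeff p * p1"
    using c[of 1] C(2) deg by simp
  show "2 * coeff p (n + 1) = lead_coeff p * (p1\<^sup>2 - p2)"
    using c[of 2] C(3)[symmetric] deg by simp
  show "6 * coeff p n = lead_coeff p * (- (p1 ^ 3) + 3 * p1 * p2 - 2 * p3)"
    using c[of 3] C(4)[symmetric] deg by simp
qed

lemma sum_mset_conv_sum_count:
  fixes g :: "'a \<Rightarrow> 'b::comm_semiring_1"
  assumes "finite T" "set_mset A \<subseteq> T"
  shows "(\<Sum>x\<in>#A. g x) = (\<Sum>x\<in>T. of_nat (count A x) * g x)"
  using assms(2)
proof (induction A)
  case (add y A)
  have "(\<Sum>x\<in>T. of_nat (count (add_mset y A) x) * g x)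
      = (\<Sum>x\<in>T. of_nat (count A x) * g x + (if x = y then g x else 0))"
    by (intro sum.cong) (auto simp: algebra_simps)
  also have "\<dots> = (\<Sum>x\<in>#A. g x) + g y"
    using add assms(1) by (simp add: sum.distrib)
  finally show ?case by (simp add: add.commute)
qed simp

text \<open>Relates \<open>(n + 3)! / 3!\<close> and \<open>(n + 5)! / 5!\<close>, the factors that
  \<open>n\<close> differentiations put on the coefficients ending up in degrees 3 and 5. The
  product \<open>pochhammer 4 (n + 2)\<close> is split at either end.\<close>

lemma pochhammer_4_6:
  "20 * pochhammer 6 n = pochhammer 4 n * ((of_nat n + 4) * (of_nat n + 5) :: 'a::comm_ring_1)"
proof -
  have "pochhammer 4 (Suc (Suc n)) = 4 * (5 * pochhammer (6::'a) n)"
    by (simp add: pochhammer_rec)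
  moreover have "pochhammer 4 (Suc (Suc n)) = ((4::'a) + of_nat (Suc n)) * ((4 + of_nat n) * pochhammer 4 n)"
    unfolding pochhammer_rec' ..
  ultimately show ?thesis by (simp add: algebra_simps)
qed

text \<open>The equations state that the roots \<open>0, 1, u, v\<close> have the prescribed first three power sums
  \<open>0, N (N - 1), 0\<close>. The names give the multiplicities of \<open>1\<close> and \<open>u\<close>; that of \<open>v\<close> is \<open>k\<close>, and in the
  last two lemmas \<open>0\<close> is simple, so that \<open>N = k + 4\<close>.\<close>
lemma power_sums_1_1:
  fixes u v :: real and k :: nat
  assumes "k \<ge> 1" "v \<noteq> 0" "u \<noteq> 0" "u \<noteq> 1" "k * v + 1 + u = 0" "k * v ^ 3 + 1 + u ^ 3 = 0"
  shows False
proof -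
  have u: "u + 1 \<noteq> 0"
  proof
    assume "u + 1 = 0"
    hence "real k * v = 0" using assms by linarith
    thus False using assms by simp
  qed
  have kv: "real k * v = - (1 + u)" using assms by simp
  \<comment> \<open>Multiplying the cubic equation by \<open>k\<^sup>2\<close> brings in
    \<open>k * v\<close>, so the linear equation eliminates \<open>v\<close>.\<close>
  have "(real k)\<^sup>2 * (real k * v ^ 3) = (real k * v) ^ 3" by (simp add: power2_eq_square power3_eq_cube)
  also have "real k * v ^ 3 = - (1 + u ^ 3)" using assms by simp
  finally have "(real k)\<^sup>2 * (1 + u ^ 3) = (1 + u) ^ 3"
    unfolding kv power_minus_odd[OF odd_numeral] mult_minus_right by simp
  hence "(1 + u) * ((real k)\<^sup>2 * (1 - u + u\<^sup>2)) = (1 + u) * (1 + u)\<^sup>2"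
    by (simp add: algebra_simps power2_eq_square power3_eq_cube)
  hence e: "(real k)\<^sup>2 * (1 - u + u\<^sup>2) = (1 + u)\<^sup>2" using u by (simp add: add.commute)
  show False
  proof (cases "k = 1")
    case True thus False using e \<open>u \<noteq> 0\<close> by (simp add: power2_eq_square algebra_simps)
  next
    case False
    define K where "K = (real k)\<^sup>2"
    have K: "K \<ge> 4" using False assms(1) power_mono[of 2 "real k" 2] by (simp add: K_def)
    \<comment> \<open>Two rewritings of \<open>e\<close>: this one shows \<open>u > 0\<close>, and
      the one with \<open>(u - 1)\<^sup>2\<close> then contradicts \<open>K \<ge> 4\<close>.\<close>
    have "(K + 2) * u = (K - 1) * (u\<^sup>2 + 1)" using e by (simp add: K_def power2_eq_square algebra_simps)
    moreover have "(K - 1) * (u\<^sup>2 + 1) > 0" using K by (intro mult_pos_pos) (auto simp: add_nonneg_pos)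
    ultimately have "(K + 2) * u > 0" by (simp only:)
    hence "u > 0" using zero_less_mult_pos[of "K + 2" u] K by simp
    have "(K - 1) * (u - 1)\<^sup>2 = (4 - K) * u" using e by (simp add: K_def power2_eq_square algebra_simps)
    moreover have "(K - 1) * (u - 1)\<^sup>2 > 0" using K \<open>u \<noteq> 1\<close> by (intro mult_pos_pos) auto
    moreover have "(4 - K) * u \<le> 0" using K \<open>u > 0\<close> by (simp add: mult_nonpos_nonneg)
    ultimately show False by simp
  qed
qed

lemma power_sums_1_2:
  fixes u v :: real and k :: nat
  assumes k: "k \<ge> 1" and v: "v \<noteq> 1" and p: "k * v + 1 + 2 * u = 0" "k * v\<^sup>2 + 1 + 2 * u\<^sup>2 = (k + 4) * (k + 3)"
    "k * v ^ 3 + 1 + 2 * u ^ 3 = 0" and u: "u \<noteq> 0"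
  shows False
proof -
  have kv: "real k * v = - (1 + 2 * u)" using p by simp
  have "(real k)\<^sup>2 * (real k * v ^ 3) = (real k * v) ^ 3" by (simp add: power2_eq_square power3_eq_cube)
  also have "real k * v ^ 3 = - (1 + 2 * u ^ 3)" using p(3) by simp
  finally have e1: "(real k)\<^sup>2 * (1 + 2 * u ^ 3) = (1 + 2 * u) ^ 3" unfolding kv power_minus_odd[OF odd_numeral] mult_minus_right by simp
  have "(real k * v)\<^sup>2 + k * (1 + 2 * u\<^sup>2) = k * (k * v\<^sup>2 + 1 + 2 * u\<^sup>2)"
    by (simp add: algebra_simps power2_eq_square)
  hence e2: "(1 + 2 * u)\<^sup>2 + k * (1 + 2 * u\<^sup>2) = real k * real ((k + 4) * (k + 3))" unfolding p(2) kv power2_minus by simp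
  consider "k = 1" | "k = 2" | "k \<ge> 3" using k by linarith
  thus False
  proof cases
    case 1
    have "6 * u * (u + 1)\<^sup>2 = 0" using e1 1 by (simp add: algebra_simps power2_eq_square power3_eq_cube)
    hence "u = -1" using u by simp
    thus False using kv v 1 by simp
  next
    case 2
    \<comment> \<open>The nonconstant parts are proportional, with ratio 3 to 2, but the constants
      are not.\<close>
    have "12 * u\<^sup>2 + 6 * u - 3 = 0" "8 * u\<^sup>2 + 4 * u - 57 = 0"
      using e1 e2 2 by (simp_all add: algebra_simps power2_eq_square power3_eq_cube)
    thus False by simp
  next
    case 3
    \<comment> \<open>For small \<open>u\<close> the left side of \<open>e2\<close> is at most
      \<open>25 + 9 * k\<close>, the right side at least \<open>42 * k\<close>.\<close>
    have big: "\<bar>u\<bar> > 2"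
    proof (rule ccontr)
      assume "\<not> ?thesis"
      hence a: "\<bar>u\<bar> \<le> 2" by simp
      hence u2: "u\<^sup>2 \<le> 4" using power_mono[of "\<bar>u\<bar>" 2 2] by simp
      have "(1 + 2 * u)\<^sup>2 = 1 + 4 * u + 4 * u\<^sup>2" by (simp add: algebra_simps power2_eq_square)
      hence l1: "(1 + 2 * u)\<^sup>2 \<le> 25" using u2 a by linarith
      have l2: "real k * (1 + 2 * u\<^sup>2) \<le> real k * 9" using u2 by (intro mult_left_mono) auto
      have "(7::nat) * 6 \<le> (k + 4) * (k + 3)" using 3 by (intro mult_mono) auto
      hence "real (7 * 6) \<le> real ((k + 4) * (k + 3))" unfolding of_nat_le_iff .
      hence "real k * 42 \<le> real k * ((k + 4) * (k + 3))" by (intro mult_left_mono) auto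
      moreover have "real k \<ge> 3" using 3 by simp
      ultimately show False using l1 l2 e2 by linarith
    qed
    \<comment> \<open>For large \<open>u\<close> the cubic terms of \<open>e1\<close> decide:
      coefficient at least 18 on the left, 8 on the right.\<close>
    have K: "(real k)\<^sup>2 \<ge> 9" using 3 power_mono[of 3 "real k" 2] by simp
    show False
    proof (cases "u > 0")
      case True
      hence "u > 2" using big by simp
      have "9 * (1 + 2 * u ^ 3) \<le> (real k)\<^sup>2 * (1 + 2 * u ^ 3)" using K True by (intro mult_right_mono) auto
      hence "10 * u ^ 3 + 8 \<le> 12 * u\<^sup>2 + 6 * u" using e1 by (simp add: algebra_simps power2_eq_square power3_eq_cube)
      moreover have "u ^ 3 \<ge> u\<^sup>2 * 2"
        using mult_left_mono[of 2 u "u\<^sup>2"] \<open>u > 2\<close> by (simp add: power2_eq_square power3_eq_cube)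
      moreover have "u\<^sup>2 \<ge> u * 2"
        using mult_left_mono[of 2 u u] \<open>u > 2\<close> by (simp add: power2_eq_square)
      ultimately show False using \<open>u > 2\<close> by linarith
    next
      case False
      define w where "w = - u"
      have w: "w > 2" using big False by (simp add: w_def)
      have w3: "w ^ 3 \<ge> 8" using power_mono[of 2 w 3] w by simp
      have "9 * (2 * w ^ 3 - 1) \<le> (real k)\<^sup>2 * (2 * w ^ 3 - 1)" using K w3 by (intro mult_right_mono) auto
      also have "\<dots> = (2 * w - 1) ^ 3" using e1 by (simp add: w_def algebra_simps power2_eq_square power3_eq_cube)
      also have "\<dots> \<le> (2 * w) ^ 3" using w by (intro power_mono) auto
      finally show False using w3 by simp
    qed
  qed
qed

lemma power_sums_2_1:
  fixes u v :: real and k :: nat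
  assumes k: "k \<ge> 1" and v: "u \<noteq> v" and p: "k * v + 2 + u = 0" "k * v\<^sup>2 + 2 + u\<^sup>2 = (k + 4) * (k + 3)"
    "k * v ^ 3 + 2 + u ^ 3 = 0" and u: "u \<noteq> 0"
  shows False
proof -
  have kv: "real k * v = - (2 + u)" using p by simp
  have "(real k)\<^sup>2 * (real k * v ^ 3) = (real k * v) ^ 3" by (simp add: power2_eq_square power3_eq_cube)
  also have "real k * v ^ 3 = - (2 + u ^ 3)" using p(3) by simp
  finally have e1: "(real k)\<^sup>2 * (2 + u ^ 3) = (2 + u) ^ 3" unfolding kv power_minus_odd[OF odd_numeral] mult_minus_right by simp
  have "(real k * v)\<^sup>2 + k * (2 + u\<^sup>2) = k * (k * v\<^sup>2 + 2 + u\<^sup>2)"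
    by (simp add: algebra_simps power2_eq_square)
  hence e2: "(2 + u)\<^sup>2 + k * (2 + u\<^sup>2) = real k * real ((k + 4) * (k + 3))" unfolding p(2) kv power2_minus by simp
  consider "k = 1" | "k = 2" | "k \<ge> 3" using k by linarith
  thus False
  proof cases
    case 1
    \<comment> \<open>The only solution is \<open>u = v = -1\<close>.\<close>
    have "6 * (u + 1)\<^sup>2 = 0" using e1 1 by (simp add: algebra_simps power2_eq_square power3_eq_cube)
    hence "u = -1" by simp
    thus False using kv v 1 by simp
  next
    case 2
    have "3 * u * (u\<^sup>2 - 2 * u - 4) = 0" and q: "3 * u\<^sup>2 + 4 * u = 52"
      using e1 e2 2 by (simp_all add: algebra_simps power2_eq_square power3_eq_cube)
    hence s: "u\<^sup>2 = 2 * u + 4" using u by simp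
    hence "u = 4" using q by simp
    thus False using s by simp
  next
    case 3
    \<comment> \<open>Again by size in \<open>e2\<close>: at most \<open>16 + 6 * k\<close> against
      at least \<open>42 * k\<close>.\<close>
    have big: "\<bar>u\<bar> > 2"
    proof (rule ccontr)
      assume "\<not> ?thesis"
      hence a: "\<bar>u\<bar> \<le> 2" by simp
      hence u2: "u\<^sup>2 \<le> 4" using power_mono[of "\<bar>u\<bar>" 2 2] by simp
      have "(2 + u)\<^sup>2 = 4 + 4 * u + u\<^sup>2" by (simp add: algebra_simps power2_eq_square)
      hence l1: "(2 + u)\<^sup>2 \<le> 16" using u2 a by linarith
      have l2: "real k * (2 + u\<^sup>2) \<le> real k * 6" using u2 by (intro mult_left_mono) auto
      have "(7::nat) * 6 \<le> (k + 4) * (k + 3)" using 3 by (intro mult_mono) auto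
      hence "real (7 * 6) \<le> real ((k + 4) * (k + 3))" unfolding of_nat_le_iff .
      hence "real k * 42 \<le> real k * ((k + 4) * (k + 3))" by (intro mult_left_mono) auto
      moreover have "real k \<ge> 3" using 3 by simp
      ultimately show False using l1 l2 e2 by linarith
    qed
    \<comment> \<open>In \<open>e1\<close> the cubic terms now have coefficients at least 9 and
      1.\<close>
    have K: "(real k)\<^sup>2 \<ge> 9" using 3 power_mono[of 3 "real k" 2] by simp
    show False
    proof (cases "u > 0")
      case True
      hence u2: "u > 2" using big by simp
      have u3: "u ^ 3 > 0" using True by simp
      have "9 * (2 + u ^ 3) \<le> (real k)\<^sup>2 * (2 + u ^ 3)" using K True by (intro mult_right_mono) auto
      also have "\<dots> \<le> (2 * u) ^ 3" unfolding e1 using u2 by (intro power_mono) auto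
      finally show False using u3 by simp
    next
      case False
      define w where "w = - u"
      have w: "w > 2" using big False by (simp add: w_def)
      have w3: "w ^ 3 \<ge> 8" using power_mono[of 2 w 3] w by simp
      have "9 * (w ^ 3 - 2) \<le> (real k)\<^sup>2 * (w ^ 3 - 2)" using K w3 by (intro mult_right_mono) auto
      also have "\<dots> = (w - 2) ^ 3" using e1 by (simp add: w_def algebra_simps power2_eq_square power3_eq_cube)
      also have "\<dots> \<le> w ^ 3" using w by (intro power_mono) auto
      finally show False using w3 by simp
    qed
  qed
qed

subsection \<open>Four collinear roots\<close>

lemma higher_pderiv_vanishes_below_order:
  fixes p :: "complex poly"
  assumes "i < order v p"
  shows "poly ((pderiv ^^ i) p) v = 0"
  using assms
proof (induction i arbitrary: p)
  case 0
  thus ?case by (metis funpow_0 not_less_zero order_root)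
next
  case (Suc i)
  show ?case
  proof (cases "p = 0")
    case False
    have "poly p v = 0" using Suc.prems by (metis not_less_zero order_root)
    hence "order v p = Suc (order v (pderiv p))" using False by (rule order_pderiv[rotated])
    thus ?thesis using Suc by (simp add: funpow_swap1)
  qed simp
qed

lemma higher_pderiv_pcompose_linear:
  fixes p :: "'a::idom poly"
  shows "(pderiv ^^ i) (pcompose p [:c, s:]) = smult (s ^ i) (pcompose ((pderiv ^^ i) p) [:c, s:])"
proof (induction i)
  case (Suc i)
  thus ?case by (simp add: pderiv_smult pderiv_pcompose pderiv_pCons mult.commute)
qed simp

text \<open>Each of the four roots has multiplicity at most \<open>n + 2\<close>, while a real
  common root of the derivatives of orders \<open>i\<close> and \<open>i + 1\<close> needs
  \<open>i + 2\<close>. So above order \<open>n\<close> the common roots alternate, starting with 0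
  at order \<open>n + 4\<close>, as long as the order is at least \<open>k\<close>.\<close>

lemma collinear_four_roots_normalised:
  fixes g :: "complex poly" and u v :: real
  assumes ca: "casas_alvero g" and deg: "degree g = n + 5"
    and roots: "{z. poly g z = 0} = {0, 1, of_real u, of_real v}"
    and dist: "u \<notin> {0, 1}" "v \<notin> {0, 1}" "u \<noteq> v"
    and nz: "\<And>i w. order (of_real v) g \<le> i \<Longrightarrow> i \<le> degree g \<Longrightarrow> w \<in> {u, v} \<Longrightarrow>
               poly ((pderiv ^^ i) g) (of_real w) \<noteq> 0"
    and c: "poly ((pderiv ^^ (n + 4)) g) 0 = 0"
  shows False
proof -
  have g0: "g \<noteq> 0" using deg by auto
  define k where "k = order (of_real v) g"
  define \<alpha> where "\<alpha> = order 0 g"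
  define \<beta> where "\<beta> = order 1 g"
  define \<gamma> where "\<gamma> = order (of_real u) g"
  have root_iff: "poly g z = 0 \<longleftrightarrow> z \<in> {0, 1, of_real u, of_real v}" for z using roots by blast
  have pos: "k \<ge> 1" "\<alpha> \<ge> 1" "\<beta> \<ge> 1" "\<gamma> \<ge> 1"
    using g0 unfolding k_def \<alpha>_def \<beta>_def \<gamma>_def
    by (simp_all add: Suc_le_eq order_gt_0_iff root_iff)
  have sum4: "(\<Sum>x\<in>{0, 1, of_real u, of_real v}. h x) = h 0 + h 1 + h (of_real u) + h (of_real v)"
    for h :: "complex \<Rightarrow> 'b::comm_monoid_add"
    using dist by (simp add: add.assoc)
  have tot: "\<alpha> + \<beta> + \<gamma> + k = n + 5"
    using sum_order_eq_degree[OF g0] unfolding roots sum4 deg by (simp add: \<alpha>_def \<beta>_def \<gamma>_def k_def)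
  have real: "z \<in> \<real>" if "poly g z = 0" for z using that root_iff[of z] by auto
  have adj: "i + 2 \<le> order z g"
    if "z \<in> \<real>" "i < n + 4" "poly ((pderiv ^^ i) g) z = 0" "poly ((pderiv ^^ Suc i) g) z = 0" for i z
  proof (rule order_ge_if_pderivs_vanish[OF g0])
    fix j assume "j < i + 2"
    thus "poly ((pderiv ^^ j) g) z = 0"
      using real_rooted_pderivs_common_root[of g i z j] real that deg by simp
  qed
  have common: "poly ((pderiv ^^ i) g) 0 = 0 \<or> poly ((pderiv ^^ i) g) 1 = 0"
    if "k \<le> i" "i < n + 5" for i
  proof -
    have i: "1 \<le> i" "i < degree g" using that pos deg by auto
    obtain z where z: "poly g z = 0" "poly ((pderiv ^^ i) g) z = 0"
      using casas_alvero_common_root[OF ca i] .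
    have "z \<noteq> of_real u" "z \<noteq> of_real v"
      using nz[of i u] nz[of i v] z(2) that i by (auto simp: k_def)
    thus ?thesis using z root_iff[of z] by auto
  qed
  \<comment> \<open>The last derivatives of \<open>g\<close>, from order \<open>n\<close> on, are
    those of this quintic.\<close>
  define q where "q = (pderiv ^^ n) g"
  define q0 q1 q2 q3 q4 q5 where "q0 = coeff q 0" and "q1 = coeff q 1" and "q2 = coeff q 2"
    and "q3 = coeff q 3" and "q4 = coeff q 4" and "q5 = coeff q 5"
  have degq: "degree q = 5" by (simp add: q_def degree_higher_pderiv deg)
  have q: "q = [:q0, q1, q2, q3, q4, q5:]"
  proof (rule poly_eqI)
    fix j show "coeff q j = coeff [:q0, q1, q2, q3, q4, q5:] j"
    proof (cases "j \<le> 5")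
      case True
      hence "j = 0 \<or> j = 1 \<or> j = 2 \<or> j = 3 \<or> j = 4 \<or> j = 5" by linarith
      thus ?thesis by (auto simp: q0_def q1_def q2_def q3_def q4_def q5_def numeral_eq_Suc)
    next
      case False
      have "degree [:q0, q1, q2, q3, q4, q5:] \<le> 5" by simp
      thus ?thesis using False degq by (simp add: coeff_eq_0 del: degree_pCons_eq_if)
    qed
  qed
  have D: "(pderiv ^^ (n + i)) g = (pderiv ^^ i) q" for i
    unfolding q_def by (subst add.commute) (simp add: funpow_add)
  have it: "(pderiv ^^ 2) h = pderiv (pderiv h)" "(pderiv ^^ 3) h = pderiv (pderiv (pderiv h))"
    "(pderiv ^^ 4) h = pderiv (pderiv (pderiv (pderiv h)))" for h :: "complex poly"
    by (simp_all add: eval_nat_numeral)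
  have D0: "poly ((pderiv ^^ n) g) z = poly [:q0, q1, q2, q3, q4, q5:] z" for z
    using D[of 0] q by simp
  have D1: "poly ((pderiv ^^ (n + 1)) g) z = poly [:q1, 2 * q2, 3 * q3, 4 * q4, 5 * q5:] z" for z
    unfolding D q by (simp add: pderiv_pCons algebra_simps)
  have D2: "poly ((pderiv ^^ (n + 2)) g) z = poly [:2 * q2, 6 * q3, 12 * q4, 20 * q5:] z" for z
    unfolding D q by (simp add: it pderiv_pCons algebra_simps)
  have D3: "poly ((pderiv ^^ (n + 3)) g) z = poly [:6 * q3, 24 * q4, 60 * q5:] z" for z
    unfolding D q by (simp add: it pderiv_pCons algebra_simps)
  have D4: "poly ((pderiv ^^ (n + 4)) g) z = poly [:24 * q4, 120 * q5:] z" for z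
    unfolding D q by (simp add: it pderiv_pCons algebra_simps)
  have "q5 \<noteq> 0" using degq by (metis leading_coeff_0_iff q5_def degree_0 zero_neq_numeral)
  have q4: "q4 = 0" using c D4[of 0] by simp
  have "poly ((pderiv ^^ (n + 3)) g) 0 \<noteq> 0"
    using adj[of 0 "n + 3"] c tot pos by (auto simp: \<alpha>_def eval_nat_numeral)
  hence d3: "poly ((pderiv ^^ (n + 3)) g) 1 = 0" using common[of "n + 3"] tot pos by auto
  hence q3: "q3 = - 10 * q5" using D3[of 1] q4 by (simp add: add_eq_0_iff2)
  have "poly ((pderiv ^^ (n + 2)) g) 1 \<noteq> 0"
    using adj[of 1 "n + 2"] d3 tot pos by (auto simp: \<beta>_def eval_nat_numeral)
  hence d2: "poly ((pderiv ^^ (n + 2)) g) 0 = 0" using common[of "n + 2"] tot pos by auto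
  hence q2: "q2 = 0" using D2[of 0] by simp
  have cq: "coeff q j = pochhammer (of_nat (Suc j)) n * coeff g (n + j)" for j
    by (simp add: q_def coeff_higher_pderiv add.commute)
  have poch: "pochhammer (of_nat (Suc j) :: complex) n \<noteq> 0" for j
    using pochhammer_pos[of "Suc j" n] unfolding pochhammer_of_nat of_nat_eq_0_iff by simp
  have c4: "coeff g (n + 4) = 0" using q4 cq[of 4] poch[of 4] by (simp add: q4_def)
  have c2: "coeff g (n + 2) = 0" using q2 cq[of 2] poch[of 2] by (simp add: q2_def)
  have lc: "lead_coeff g = coeff g (n + 5)" "coeff g (n + 5) \<noteq> 0"
    using deg g0 by (simp, metis leading_coeff_0_iff)
  \<comment> \<open>This carries \<open>q3 = - 10 * q5\<close> over to the coefficients of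
    \<open>g\<close>.\<close>
  have "pochhammer 4 n * (2 * coeff g (n + 3)) = 2 * q3" using cq[of 3] by (simp add: q3_def)
  also have "\<dots> = - (20 * pochhammer 6 n * coeff g (n + 5))" using cq[of 5] q3 by (simp add: q5_def)
  also have "\<dots> = pochhammer 4 n * (- ((of_nat n + 4) * (of_nat n + 5)) * coeff g (n + 5))"
    unfolding pochhammer_4_6 by simp
  finally have "pochhammer 4 n * (2 * coeff g (n + 3))
      = pochhammer 4 n * (- ((of_nat n + 4) * (of_nat n + 5)) * coeff g (n + 5))" .
  hence c3: "2 * coeff g (n + 3) = - ((of_nat n + 4) * (of_nat n + 5)) * coeff g (n + 5)"
    using poch[of 3] by (subst (asm) mult_cancel_left) simp
  have ps: "(\<Sum>x\<in>#proots g. x ^ m) = of_real (\<alpha> * 0 ^ m + \<beta> + \<gamma> * u ^ m + k * v ^ m)" for m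
    using sum_mset_conv_sum_count[of "{0, 1, of_real u, of_real v}" "proots g" "\<lambda>x. x ^ m"] g0 roots
    unfolding sum4 by (simp add: \<alpha>_def \<beta>_def \<gamma>_def k_def)
  \<comment> \<open>The shift by 2 makes Newton's identities speak of the coefficients
    \<open>n + 4\<close>, \<open>n + 3\<close> and \<open>n + 2\<close> just found.\<close>
  have deg': "degree g = (n + 2) + 3" using deg by simp
  have "n + 2 + 2 = n + 4" "n + 2 + 1 = n + 3" by simp_all
  note nt = newton_top_coeffs[OF deg', unfolded this lc(1)]
  have s1: "(\<Sum>x\<in>#proots g. x) = 0" using nt(1) c4 lc by simp
  have s2: "(\<Sum>x\<in>#proots g. x\<^sup>2) = (of_nat n + 4) * (of_nat n + 5)"
  proof -
    have "coeff g (n + 5) * (\<Sum>x\<in>#proots g. x\<^sup>2) = - (2 * coeff g (n + 3))"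
      unfolding nt(2) s1 by simp
    also have "\<dots> = coeff g (n + 5) * ((of_nat n + 4) * (of_nat n + 5))"
      unfolding c3 by simp
    finally have "coeff g (n + 5) * (\<Sum>x\<in>#proots g. x\<^sup>2)
      = coeff g (n + 5) * ((of_nat n + 4) * (of_nat n + 5))" .
    thus ?thesis using lc by simp
  qed
  have s3: "(\<Sum>x\<in>#proots g. x ^ 3) = 0" using nt(3) c2 lc s1 by simp
  have "of_real (\<alpha> * 0 ^ 1 + \<beta> + \<gamma> * u ^ 1 + k * v ^ 1) = complex_of_real 0"
    unfolding ps[of 1, symmetric] using s1 by simp
  hence p1: "k * v + \<beta> + \<gamma> * u = 0" unfolding of_real_eq_iff by simp
  have "of_real (\<alpha> * 0\<^sup>2 + \<beta> + \<gamma> * u\<^sup>2 + k * v\<^sup>2) = complex_of_real ((n + 4) * (n + 5))"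
    unfolding ps[of 2, symmetric] s2 by simp
  hence p2: "k * v\<^sup>2 + \<beta> + \<gamma> * u\<^sup>2 = (n + 4) * (n + 5)"
    unfolding of_real_eq_iff by simp
  have "of_real (\<alpha> * 0 ^ 3 + \<beta> + \<gamma> * u ^ 3 + k * v ^ 3) = complex_of_real 0"
    unfolding ps[of 3, symmetric] using s3 by simp
  hence p3: "k * v ^ 3 + \<beta> + \<gamma> * u ^ 3 = 0" unfolding of_real_eq_iff by simp
  show False
  proof (cases "k \<le> n")
    case True
    have "poly ((pderiv ^^ (n + 1)) g) 0 \<noteq> 0"
      using adj[of 0 "n + 1"] d2 tot pos by (auto simp: \<alpha>_def eval_nat_numeral)
    hence d1: "poly ((pderiv ^^ (n + 1)) g) 1 = 0" using common[of "n + 1"] True by auto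
    hence q1: "q1 = 25 * q5" using D1[of 1] q2 q3 q4 by (simp add: add_eq_0_iff2)
    \<comment> \<open>At order \<open>n\<close> multiplicities alone allow one exception:
      \<open>\<beta> = n + 2\<close> with the other roots simple. Then \<open>p1\<close> and
      \<open>p3\<close> give \<open>3 u v = B\<^sup>2 - 1\<close> and \<open>p2\<close> gives
      \<open>2 u v = - 4 B - 6\<close>, so \<open>B\<^sup>2 + 6 B + 8 = 0\<close>, impossible for
      \<open>B \<ge> 0\<close>.\<close>
    have "poly ((pderiv ^^ n) g) 1 \<noteq> 0"
    proof
      assume "poly ((pderiv ^^ n) g) 1 = 0"
      hence "n + 2 \<le> \<beta>" using adj[of 1 n] d1 by (simp add: \<beta>_def)
      hence b: "\<beta> = n + 2" "\<gamma> = 1" "k = 1" using tot pos by linarith+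
      define B where "B = real \<beta>"
      have B: "B + u + v = 0" "B + u\<^sup>2 + v\<^sup>2 = (B + 2) * (B + 3)" "B + u ^ 3 + v ^ 3 = 0" "B \<ge> 0"
        using p1 p2 p3 b by (simp_all add: B_def add_ac)
      have Buv: "B = - (u + v)" using B(1) by simp
      have "3 * (u + v) * (u * v) = (u + v) ^ 3 - (u ^ 3 + v ^ 3)"
        by (simp add: algebra_simps power3_eq_cube)
      moreover have "u + v = - B" "u ^ 3 + v ^ 3 = - B" using B(1,3) by simp_all
      ultimately have "3 * (- B) * (u * v) = (- B) ^ 3 - (- B)" by (simp only:)
      hence "B * (3 * (u * v)) = B * (B\<^sup>2 - 1)"
        by (simp add: algebra_simps power2_eq_square power3_eq_cube)
      moreover have "B \<noteq> 0" using b by (simp add: B_def)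
      ultimately have "3 * (u * v) = B\<^sup>2 - 1" by simp
      moreover have "B\<^sup>2 = u\<^sup>2 + v\<^sup>2 + 2 * (u * v)" by (simp add: Buv algebra_simps power2_eq_square)
      moreover have "u\<^sup>2 + v\<^sup>2 = B\<^sup>2 + 4 * B + 6" using B(2) by (simp add: algebra_simps power2_eq_square)
      ultimately show False using B(4) zero_le_power2[of B] by linarith
    qed
    hence "poly ((pderiv ^^ n) g) 0 = 0" using common[of n] True by auto
    hence qz: "q0 = 0" using D0[of 0] by simp
    \<comment> \<open>The quintic is now \<open>q5 X (X\<^sup>2 - 5)\<^sup>2\<close>. Its double
      root \<open>s\<close> is a root of \<open>g\<close> by \<open>adj\<close>, hence
      \<open>u\<close> or \<open>v\<close>, where \<open>nz\<close> forbids the derivative of order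
      \<open>n\<close> to vanish.\<close>
    define s where "s = complex_of_real (sqrt 5)"
    have "s\<^sup>2 = complex_of_real ((sqrt 5)\<^sup>2)" unfolding s_def by (simp only: of_real_power)
    hence s2: "s\<^sup>2 = 5" by simp
    have "poly [:q0, q1, q2, q3, q4, q5:] s = s * q5 * (25 - 10 * s\<^sup>2 + (s\<^sup>2)\<^sup>2)"
      by (simp add: qz q1 q2 q3 q4 algebra_simps power2_eq_square)
    hence z0: "poly ((pderiv ^^ n) g) s = 0" unfolding D0 s2 by simp
    have "poly [:q1, 2 * q2, 3 * q3, 4 * q4, 5 * q5:] s = 5 * q5 * (5 - 6 * s\<^sup>2 + (s\<^sup>2)\<^sup>2)"
      by (simp add: qz q1 q2 q3 q4 algebra_simps power2_eq_square)
    hence z1: "poly ((pderiv ^^ Suc n) g) s = 0" using D1[of s] unfolding s2 by simp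
    have "n + 2 \<le> order s g" using adj[of s n] z0 z1 by (simp add: s_def)
    hence "poly g s = 0" using order_root[of g s] by simp
    moreover have "s \<noteq> 0" "s \<noteq> 1" using s2 by auto
    ultimately have "s = of_real u \<or> s = of_real v" using root_iff[of s] by auto
    thus False using nz[of n u] nz[of n v] z0 True deg by (auto simp: k_def)
  next
    case False
    \<comment> \<open>At most 4 is left for \<open>\<alpha> + \<beta> + \<gamma>\<close>. The first
      case covers both \<open>\<alpha> = 1\<close> and \<open>\<alpha> = 2\<close>, as the equations
      do not involve \<open>\<alpha>\<close>.\<close>
    hence "\<beta> = 1 \<and> \<gamma> = 1 \<or> \<alpha> = 1 \<and> \<beta> = 1 \<and> \<gamma> = 2 \<or> \<alpha> = 1 \<and> \<beta> = 2 \<and> \<gamma> = 1"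
      using tot pos by linarith
    thus False
    proof (elim disjE conjE)
      assume "\<beta> = 1" "\<gamma> = 1"
      thus False using power_sums_1_1[of k v u] p1 p3 dist pos by simp
    next
      assume a: "\<alpha> = 1" "\<beta> = 1" "\<gamma> = 2"
      hence "n = k - 1" "k \<ge> 1" using tot pos by auto
      thus False using a power_sums_1_2[of k v u] p1 p2 p3 dist by (simp add: of_nat_diff algebra_simps)
    next
      assume a: "\<alpha> = 1" "\<beta> = 2" "\<gamma> = 1"
      hence "n = k - 1" "k \<ge> 1" using tot pos by auto
      thus False using a power_sums_2_1[of k u v] p1 p2 p3 dist by (simp add: of_nat_diff algebra_simps)
    qed
  qed
qed

text \<open>Substituting \<open>c + \<delta> X\<close> for \<open>X\<close> moves \<open>c\<close>
  to 0 and \<open>d\<close> to 1; by collinearity \<open>a\<close> and \<open>b\<close> become real.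
  The order hypothesis makes \<open>v\<close> the extreme root of largest multiplicity.\<close>

lemma collinear_four_roots_aux:
  fixes f :: "complex poly"
  assumes ca: "casas_alvero f" and N: "degree f \<ge> 5"
    and roots: "{z. poly f z = 0} = {a, b, c, d}"
    and dist: "a \<noteq> b" "a \<notin> {c, d}" "b \<notin> {c, d}" "c \<noteq> d"
    and seg: "c \<in> closed_segment a b" "d \<in> closed_segment a b"
    and ext: "a extreme_point_of (convex hull {z. poly f z = 0})"
             "b extreme_point_of (convex hull {z. poly f z = 0})"
    and le: "order a f \<le> order b f"
    and c: "poly ((pderiv ^^ (degree f - 1)) f) c = 0"
  shows False
proof -
  have f0: "f \<noteq> 0" using N by auto
  define \<delta> where "\<delta> = d - c"
  have \<delta>: "\<delta> \<noteq> 0" using dist by (simp add: \<delta>_def)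
  obtain s t where s: "c = (1 - s) *\<^sub>R a + s *\<^sub>R b" and t: "d = (1 - t) *\<^sub>R a + t *\<^sub>R b"
    using seg by (auto simp: in_segment)
  have "s \<noteq> t" using s t dist by auto
  \<comment> \<open>Solves \<open>a = c + \<delta> u\<close> and \<open>b = c + \<delta> v\<close>
    with \<open>c = a + s (b - a)\<close> and \<open>\<delta> = (t - s) (b - a)\<close>.\<close>
  define u where "u = - s / (t - s)"
  define v where "v = (1 - s) / (t - s)"
  have \<delta>_eq: "\<delta> = (t - s) *\<^sub>R (b - a)" by (simp add: \<delta>_def s t algebra_simps)
  have "u *\<^sub>R \<delta> = (- s) *\<^sub>R (b - a)" "v *\<^sub>R \<delta> = (1 - s) *\<^sub>R (b - a)"
    using \<open>s \<noteq> t\<close> unfolding \<delta>_eq u_def v_def by simp_all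
  hence u: "a = c + \<delta> * of_real u" and v: "b = c + \<delta> * of_real v"
    by (simp_all add: s scaleR_conv_of_real algebra_simps)
  define g where "g = pcompose f [:c, \<delta>:]"
  have deg: "degree g = degree f" using \<delta> by (simp add: g_def degree_pcompose)
  have g: "poly ((pderiv ^^ i) g) z = \<delta> ^ i * poly ((pderiv ^^ i) f) (c + \<delta> * z)" for i z
    by (simp add: g_def higher_pderiv_pcompose_linear poly_pcompose mult.commute)
  have g_iff: "poly ((pderiv ^^ i) g) z = 0 \<longleftrightarrow> poly ((pderiv ^^ i) f) (c + \<delta> * z) = 0" for i z
    using \<delta> by (simp add: g)
  have g0: "g \<noteq> 0" using deg N by auto
  have roots_g: "poly g z = 0 \<longleftrightarrow> z \<in> {0, 1, of_real u, of_real v}" for z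
  proof -
    have d: "d = c + \<delta> * 1" by (simp add: \<delta>_def)
    have "poly f x = 0 \<longleftrightarrow> x \<in> {a, b, c, d}" for x using roots by blast
    hence "poly g z = 0 \<longleftrightarrow> c + \<delta> * z \<in> {a, b, c, d}" using g_iff[of 0 z] by simp
    also have "\<dots> \<longleftrightarrow> z \<in> {0, 1, of_real u, of_real v}"
      unfolding insert_iff empty_iff by (subst u, subst v, subst d) (use \<delta> in auto)
    finally show ?thesis .
  qed
  \<comment> \<open>Thus orders from \<open>order (of_real v) g\<close> on are at least the
    multiplicities of both \<open>a\<close> and \<open>b\<close> in \<open>f\<close>.\<close>
  have ge: "order b f \<le> order (of_real v) g"
  proof (rule order_ge_if_pderivs_vanish[OF g0])
    fix i assume "i < order b f"
    thus "poly ((pderiv ^^ i) g) (of_real v) = 0"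
      using higher_pderiv_vanishes_below_order[of i b f] by (simp add: g_iff v)
  qed
  show False
  proof (rule collinear_four_roots_normalised[of g "degree f - 5" u v])
    show "casas_alvero g"
      unfolding casas_alvero_def deg
    proof safe
      show "degree f \<ge> 1" using N by simp
      fix i assume "i \<in> {1..degree f - 1}"
      then obtain z where "poly f z = 0" "poly ((pderiv ^^ i) f) z = 0"
        using ca unfolding casas_alvero_def by blast
      thus "\<exists>z. poly g z = 0 \<and> poly ((pderiv ^^ i) g) z = 0"
        using g_iff[of 0 "(z - c) / \<delta>"] g_iff[of i "(z - c) / \<delta>"] \<delta>
        by (intro exI[of _ "(z - c) / \<delta>"]) simp
    qed
    show "{z. poly g z = 0} = {0, 1, of_real u, of_real v}" using roots_g by blast
    show "u \<notin> {0, 1}" "v \<notin> {0, 1}" "u \<noteq> v" using u v dist by (auto simp: \<delta>_def)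
    show "poly ((pderiv ^^ (degree f - 5 + 4)) g) 0 = 0"
    proof -
      have "degree f - 5 + 4 = degree f - 1" using N by simp
      thus ?thesis using c by (simp add: g_iff)
    qed
    fix i w assume i: "order (of_real v) g \<le> i" "i \<le> degree g" and w: "w \<in> {u, v}"
    have "poly ((pderiv ^^ i) f) a \<noteq> 0" "poly ((pderiv ^^ i) f) b \<noteq> 0"
      using pderivs_nonzero_at_extreme_root[OF f0] ext i ge le deg by simp_all
    thus "poly ((pderiv ^^ i) g) (of_real w) \<noteq> 0" using w u v by (auto simp: g_iff)
  qed (use deg N in auto)
qed

lemma casas_alvero_five_roots:
  assumes ca: "casas_alvero f" and nt: "nontrivial_poly f" and N: "degree f \<ge> 5"
  shows "card {z. poly f z = 0} \<ge> 5"
proof (rule ccontr)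
  assume contra: "\<not> ?thesis"
  define S where "S = {z. poly f z = 0}"
  have f0: "f \<noteq> 0" using N by auto
  have S: "finite S" "card S \<le> 4" using contra f0 by (auto simp: S_def poly_roots_finite)
  obtain c d where cd: "c \<noteq> d" "c \<in> S" "d \<in> S" "\<not> c extreme_point_of (convex hull S)"
    "\<not> d extreme_point_of (convex hull S)"
    using casas_alvero_two_nonextreme_roots[OF ca nt] by (auto simp: S_def)
  obtain a b where ab: "S = {a, b, c, d}" "a \<noteq> b" "a \<notin> {c, d}" "b \<notin> {c, d}"
    and seg: "c \<in> closed_segment a b" "d \<in> closed_segment a b"
    and ext: "a extreme_point_of (convex hull S)" "b extreme_point_of (convex hull S)"
    using four_points_collinear[OF S cd(2,3,1,4,5)] .
  have "(\<Sum>x\<in>{a, b, c, d}. order x f) = degree f"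
    using sum_order_eq_degree[OF f0] ab(1) by (simp add: S_def)
  hence tot: "order a f + order b f + order c f + order d f = degree f" using ab cd by auto
  have "order x f \<ge> 1" if "x \<in> S" for x using that f0 by (auto simp: S_def order_root)
  hence pos: "order a f \<ge> 1" "order b f \<ge> 1" "order c f \<ge> 1" "order d f \<ge> 1" using ab by auto
  obtain z where z: "poly f z = 0" "poly ((pderiv ^^ (degree f - 1)) f) z = 0"
  proof (rule casas_alvero_common_root[OF ca, of "degree f - 1"])
  qed (use N in auto)
  \<comment> \<open>The other three roots count at least 1 each, so \<open>a\<close> and
    \<open>b\<close> have multiplicity below \<open>degree f - 1\<close>.\<close>
  have "poly ((pderiv ^^ (degree f - 1)) f) a \<noteq> 0" "poly ((pderiv ^^ (degree f - 1)) f) b \<noteq> 0"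
    using tot pos ext unfolding S_def
    by (intro pderivs_nonzero_at_extreme_root[OF f0]; linarith)+
  hence "z = c \<or> z = d" using z ab(1) by (auto simp: S_def)
  \<comment> \<open>The configuration is symmetric in \<open>a, b\<close> and in
    \<open>c, d\<close>, so one may assume \<open>order a f \<le> order b f\<close> and
    \<open>z = c\<close>.\<close>
  define P where "P a b c d \<longleftrightarrow> S = {a, b, c, d} \<and> a \<noteq> b \<and> a \<notin> {c, d} \<and> b \<notin> {c, d} \<and> c \<noteq> d \<and>
    c \<in> closed_segment a b \<and> d \<in> closed_segment a b \<and> a extreme_point_of (convex hull S) \<and>
    b extreme_point_of (convex hull S)" for a b c d
  have "P a b c d" using ab seg ext cd by (simp add: P_def)
  hence all: "P a b c d" "P b a c d" "P a b d c" "P b a d c"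
    by (auto simp: P_def closed_segment_commute insert_commute)
  have aux: False if "P a b c d" "order a f \<le> order b f" "z = c" for a b c d
    using that(1,2) z(2)[unfolded that(3)] collinear_four_roots_aux[OF ca N, of a b c d]
    unfolding P_def S_def by blast
  show False
    using aux[OF all(1)] aux[OF all(2)] aux[OF all(3)] aux[OF all(4)] \<open>z = c \<or> z = d\<close> by linarith
qed

theorem proposition5:
  fixes f :: "complex poly" and N :: nat
  assumes "casas_alvero f"
    and "nontrivial_poly f"
    and "degree f = N"
    and "N \<ge> 5"
  shows "card {z. poly f z = 0} \<ge> 5 \<and> N \<ge> 6"
proof
  have N: "degree f \<ge> 5" using assms by simp
  show card: "card {z. poly f z = 0} \<ge> 5"
    by (rule casas_alvero_five_roots[OF assms(1,2) N])
  show "N \<ge> 6"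
  proof (rule ccontr)
    assume "\<not> N \<ge> 6"
    hence deg: "degree f = 5" using assms by simp
    have f0: "f \<noteq> 0" using N by auto
    define S where "S = {z. poly f z = 0}"
    have fin: "finite S" unfolding S_def using f0 by (rule poly_roots_finite)
    \<comment> \<open>This root has multiplicity at least 2; with at least four others the total
      exceeds 5.\<close>
    obtain z where z: "poly f z = 0" "poly (pderiv f) z = 0"
      using casas_alvero_common_root[OF assms(1), of 1] N by auto
    have "order z f = Suc (order z (pderiv f))" by (rule order_pderiv[OF f0 z(1)])
    moreover have "order z (pderiv f) \<ge> 1"
      using z deg by (auto simp: Suc_le_eq order_gt_0_iff pderiv_eq_0_iff)
    ultimately have oz: "order z f \<ge> 2" by simp
    have zS: "z \<in> S" using z by (simp add: S_def)
    have "(\<Sum>x\<in>S. order x f) = order z f + (\<Sum>x\<in>S - {z}. order x f)"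
      by (rule sum.remove[OF fin zS])
    moreover have "(\<Sum>x\<in>S - {z}. order x f) \<ge> (\<Sum>x\<in>S - {z}. 1)"
      using f0 by (intro sum_mono) (auto simp: S_def Suc_le_eq order_gt_0_iff)
    moreover have "card (S - {z}) \<ge> 4" using card zS fin by (simp add: S_def)
    ultimately show False using oz sum_order_eq_degree[OF f0] deg by (simp add: S_def)
  qed
qed

end
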